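(* Let $m\ge 1$, let $\mathcal{D}$ be a triangulated category with a bounded $t$-structure $(\mathcal{D}^{\le 0},\mathcal{D}^{\ge 0})$, and let $(\mathcal{T},\mathcal{F})$ be an $s$-torsion pair in the $m$-extended heart $\mathcal{D}^{[-(m-1),0]}$. Let $(\mathcal{C}^{\le 0},\mathcal{C}^{\ge 0})=(\mathcal{D}^{\le -m}*\mathcal{T},\ \mathcal{F}[1]*\mathcal{D}^{\ge 0})$ be the bounded $t$-structure on $\mathcal{D}$ corresponding to $(\mathcal{T},\mathcal{F})$. Then $(\mathcal{F}[m],\mathcal{T})$ is an $s$-torsion pair in the $m$-extended heart $\mathcal{C}^{[-(m-1),0]}$ of $(\mathcal{C}^{\le 0},\mathcal{C}^{\ge 0})$.
   Context: All categories are additive; subcategories are full, additive and closed under isomorphisms. $\mathrm{Hom}$ is taken in $\mathcal{D}$ and $[1]$ is the shift. For subcategories $\mathcal{X},\mathcal{Y}$ of $\mathcal{D}$, $\mathcal{X}*\mathcal{Y}$ is the subcategory of objects $Z$ admitting a triangle $X\to Z\to Y\to X[1]$ with $X\in\mathcal{X}$, $Y\in\mathcal{Y}$; $\mathrm{Hom}(\mathcal{X},\mathcal{Y})=0$ means $\mathrm{Hom}(X,Y)=0$ for all $X\in\mathcal{X}$, $Y\in\mathcal{Y}$. A bounded $t$-structure is a pair $(\mathcal{D}^{\le 0},\mathcal{D}^{\ge 0})$ of subcategories with: $\mathcal{D}^{\le 0}[1]\subseteq\mathcal{D}^{\le 0}$, $\mathcal{D}^{\ge 0}[-1]\subseteq\mathcal{D}^{\ge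 0}$; $\mathrm{Hom}(\mathcal{D}^{\le 0},\mathcal{D}^{\ge 0}[-1])=0$; $\mathcal{D}=\mathcal{D}^{\le 0}*\mathcal{D}^{\ge 0}[-1]$; and for each $X\in\mathcal{D}$ there is $n>0$ with $X[n]\in\mathcal{D}^{\le 0}$ and $X[-n]\in\mathcal{D}^{\ge 0}$. Put $\mathcal{D}^{\le p}=\mathcal{D}^{\le 0}[-p]$, $\mathcal{D}^{\ge p}=\mathcal{D}^{\ge 0}[-p]$, $\mathcal{D}^{[p,q]}=\mathcal{D}^{\ge p}\cap\mathcal{D}^{\le q}$ (and likewise for $\mathcal{C}$). The $m$-extended heart of the $t$-structure is $\mathcal{D}^{[-(m-1),0]}$. A torsion pair in an $m$-extended heart $\mathcal{E}$ is a pair $(\mathcal{T},\mathcal{F})$ of subcategories of $\mathcal{E}$ with $\mathrm{Hom}(\mathcal{T},\mathcal{F})=0$ and $\mathcal{E}=\mathcal{T}*\mathcal{F}$. It is an $s$-torsion pair if moreover $\mathrm{Hom}(\mathcal{T},\mathcal{F}[-1])=0$. Known fact (Adachi–Enomoto–Tsukamoto): $(\mathcal{T},\mathcal{F})\mapsto(\mathcal{D}^{\le -m}*\mathcal{T},\mathcal{F}[1]*\mathcal{D}^{\ge 0})$ is a bijection from $s$-torsion pairs in $\mathcal{D}^{[-(m-1),0]}$ to bounded $t$-structures $(\mathcal{C}^{\le 0},\mathcal{C}^{\ge 0})$ on $\mathcal{D}$ with $\mathcal{D}^{\le -m}\subseteq\mathcal{C}^{\le 0}\subseteq\mathcal{D}^{\le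 0}$; this is the correspondence used in the claim. *)

theory Defs
  imports "HOL-Algebra.Group"
begin

section \<open>Additive categories\<close>

text \<open>
  Every \<open>Hom D X Y\<close> is an abelian group in the sense of HOL-Algebra, hence written
  multiplicatively: \<open>\<otimes>\<close> is the addition of parallel morphisms, \<open>\<one>\<close> the zero morphism and
  \<open>inv f\<close> is \<open>-f\<close>. Distinct hom-sets are not required to be disjoint; triangles therefore
  record their objects.

  \<open>shift_obj\<close> and \<open>shift_mor\<close> form the shift functor \<open>[1]\<close>, and \<open>tri D X Y Z f g h\<close> says that
  \<open>X \<rightarrow> Y \<rightarrow> Z \<rightarrow> X[1]\<close>, with maps \<open>f\<close>, \<open>g\<close>, \<open>h\<close>, is a distinguished triangle.
\<close>

record ('o, 'm) tricat =
  Obj :: "'o set"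
  Hom :: "'o \<Rightarrow> 'o \<Rightarrow> 'm monoid"
  comp :: "'m \<Rightarrow> 'm \<Rightarrow> 'm"  (infixl \<open>\<cdot>\<index>\<close> 70)
  ident :: "'o \<Rightarrow> 'm"
  shift_obj :: "'o \<Rightarrow> 'o"
  shift_mor :: "'m \<Rightarrow> 'm"
  tri :: "'o \<Rightarrow> 'o \<Rightarrow> 'o \<Rightarrow> 'm \<Rightarrow> 'm \<Rightarrow> 'm \<Rightarrow> bool"

abbreviation homset :: "('o, 'm, 'z) tricat_scheme \<Rightarrow> 'o \<Rightarrow> 'o \<Rightarrow> 'm set" where
  "homset D X Y \<equiv> carrier (Hom D X Y)"

abbreviation zero_mor :: "('o, 'm, 'z) tricat_scheme \<Rightarrow> 'o \<Rightarrow> 'o \<Rightarrow> 'm" where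
  "zero_mor D X Y \<equiv> \<one>\<^bsub>Hom D X Y\<^esub>"

definition is_iso :: "('o, 'm, 'z) tricat_scheme \<Rightarrow> 'o \<Rightarrow> 'o \<Rightarrow> 'm \<Rightarrow> bool" where
  "is_iso D X Y f \<longleftrightarrow> f \<in> homset D X Y \<and>
     (\<exists>g \<in> homset D Y X. g \<cdot>\<^bsub>D\<^esub> f = ident D X \<and> f \<cdot>\<^bsub>D\<^esub> g = ident D Y)"

definition isomorphic_objs :: "('o, 'm, 'z) tricat_scheme \<Rightarrow> 'o \<Rightarrow> 'o \<Rightarrow> bool" where
  "isomorphic_objs D X Y \<longleftrightarrow> X \<in> Obj D \<and> Y \<in> Obj D \<and> (\<exists>f. is_iso D X Y f)"

definition is_zero_obj :: "('o, 'm, 'z) tricat_scheme \<Rightarrow> 'o \<Rightarrow> bool" where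
  "is_zero_obj D Z \<longleftrightarrow> Z \<in> Obj D \<and>
     (\<forall>X \<in> Obj D. (\<exists>!f. f \<in> homset D Z X) \<and> (\<exists>!f. f \<in> homset D X Z))"

definition is_direct_sum :: "('o, 'm, 'z) tricat_scheme \<Rightarrow> 'o \<Rightarrow> 'o \<Rightarrow> 'o \<Rightarrow> bool" where
  "is_direct_sum D X Y S \<longleftrightarrow> X \<in> Obj D \<and> Y \<in> Obj D \<and> S \<in> Obj D \<and>
     (\<exists>i \<in> homset D X S. \<exists>j \<in> homset D Y S. \<exists>p \<in> homset D S X. \<exists>q \<in> homset D S Y.
        p \<cdot>\<^bsub>D\<^esub> i = ident D X \<and> q \<cdot>\<^bsub>D\<^esub> j = ident D Y \<and>
        p \<cdot>\<^bsub>D\<^esub> j = zero_mor D Y X \<and> q \<cdot>\<^bsub>D\<^esub> i = zero_mor D X Y \<and>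
        (i \<cdot>\<^bsub>D\<^esub> p) \<otimes>\<^bsub>Hom D S S\<^esub> (j \<cdot>\<^bsub>D\<^esub> q) = ident D S)"

locale additive_category =
  fixes D (structure)
  assumes ident_closed: "X \<in> Obj D \<Longrightarrow> ident D X \<in> homset D X X"
    and comp_closed:
      "\<lbrakk>X \<in> Obj D; Y \<in> Obj D; Z \<in> Obj D; f \<in> homset D X Y; g \<in> homset D Y Z\<rbrakk>
        \<Longrightarrow> g \<cdot> f \<in> homset D X Z"
    and comp_assoc:
      "\<lbrakk>X \<in> Obj D; Y \<in> Obj D; Z \<in> Obj D; W \<in> Obj D;
        f \<in> homset D X Y; g \<in> homset D Y Z; h \<in> homset D Z W\<rbrakk>
        \<Longrightarrow> (h \<cdot> g) \<cdot> f = h \<cdot> (g \<cdot> f)"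
    and comp_ident_left:
      "\<lbrakk>X \<in> Obj D; Y \<in> Obj D; f \<in> homset D X Y\<rbrakk> \<Longrightarrow> ident D Y \<cdot> f = f"
    and comp_ident_right:
      "\<lbrakk>X \<in> Obj D; Y \<in> Obj D; f \<in> homset D X Y\<rbrakk> \<Longrightarrow> f \<cdot> ident D X = f"
    and hom_comm_group: "\<lbrakk>X \<in> Obj D; Y \<in> Obj D\<rbrakk> \<Longrightarrow> comm_group (Hom D X Y)"
    and comp_additive_left:
      "\<lbrakk>X \<in> Obj D; Y \<in> Obj D; Z \<in> Obj D; f \<in> homset D X Y\<rbrakk>
        \<Longrightarrow> (\<lambda>g. g \<cdot> f) \<in> hom (Hom D Y Z) (Hom D X Z)"
    and comp_additive_right:
      "\<lbrakk>X \<in> Obj D; Y \<in> Obj D; Z \<in> Obj D; g \<in> homset D Y Z\<rbrakk>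
        \<Longrightarrow> (\<lambda>f. g \<cdot> f) \<in> hom (Hom D X Y) (Hom D X Z)"
    and zero_obj_exists: "\<exists>Z. is_zero_obj D Z"
    and direct_sum_exists: "\<lbrakk>X \<in> Obj D; Y \<in> Obj D\<rbrakk> \<Longrightarrow> \<exists>S. is_direct_sum D X Y S"


section \<open>Triangulated categories\<close>

text \<open>The shift is an automorphism (not merely an autoequivalence), as in Verdier's definition.\<close>

locale triangulated_category = additive_category D for D (structure) +
  assumes shift_obj_bij: "bij_betw (shift_obj D) (Obj D) (Obj D)"
    and shift_mor_iso:
      "\<lbrakk>X \<in> Obj D; Y \<in> Obj D\<rbrakk>
        \<Longrightarrow> shift_mor D \<in> iso (Hom D X Y) (Hom D (shift_obj D X) (shift_obj D Y))"
    and shift_ident: "X \<in> Obj D \<Longrightarrow> shift_mor D (ident D X) = ident D (shift_obj D X)"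
    and shift_comp:
      "\<lbrakk>X \<in> Obj D; Y \<in> Obj D; Z \<in> Obj D; f \<in> homset D X Y; g \<in> homset D Y Z\<rbrakk>
        \<Longrightarrow> shift_mor D (g \<cdot> f) = shift_mor D g \<cdot> shift_mor D f"
    and tri_closed:
      "tri D X Y Z f g h \<Longrightarrow>
        X \<in> Obj D \<and> Y \<in> Obj D \<and> Z \<in> Obj D \<and>
        f \<in> homset D X Y \<and> g \<in> homset D Y Z \<and> h \<in> homset D Z (shift_obj D X)"
    \<comment> \<open>TR1\<close>
    and tri_ident:
      "\<lbrakk>X \<in> Obj D; is_zero_obj D Z\<rbrakk>
        \<Longrightarrow> tri D X X Z (ident D X) (zero_mor D X Z) (zero_mor D Z (shift_obj D X))"
    and tri_iso:
      "\<lbrakk>tri D X Y Z f g h; X' \<in> Obj D; Y' \<in> Obj D; Z' \<in> Obj D;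
        f' \<in> homset D X' Y'; g' \<in> homset D Y' Z'; h' \<in> homset D Z' (shift_obj D X');
        is_iso D X X' u; is_iso D Y Y' v; is_iso D Z Z' w;
        v \<cdot> f = f' \<cdot> u; w \<cdot> g = g' \<cdot> v; shift_mor D u \<cdot> h = h' \<cdot> w\<rbrakk>
        \<Longrightarrow> tri D X' Y' Z' f' g' h'"
    and tri_cone:
      "\<lbrakk>X \<in> Obj D; Y \<in> Obj D; f \<in> homset D X Y\<rbrakk> \<Longrightarrow> \<exists>Z g h. tri D X Y Z f g h"
    \<comment> \<open>TR2\<close>
    and tri_rotate:
      "\<lbrakk>X \<in> Obj D; Y \<in> Obj D; Z \<in> Obj D;
        f \<in> homset D X Y; g \<in> homset D Y Z; h \<in> homset D Z (shift_obj D X)\<rbrakk>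
        \<Longrightarrow> tri D X Y Z f g h \<longleftrightarrow>
            tri D Y Z (shift_obj D X) g h
              (inv\<^bsub>Hom D (shift_obj D X) (shift_obj D Y)\<^esub> (shift_mor D f))"
    \<comment> \<open>TR3\<close>
    and tri_fill:
      "\<lbrakk>tri D X Y Z f g h; tri D X' Y' Z' f' g' h';
        u \<in> homset D X X'; v \<in> homset D Y Y'; v \<cdot> f = f' \<cdot> u\<rbrakk>
        \<Longrightarrow> \<exists>w \<in> homset D Z Z'. w \<cdot> g = g' \<cdot> v \<and> shift_mor D u \<cdot> h = h' \<cdot> w"
    \<comment> \<open>TR4, the octahedral axiom\<close>
    and tri_octahedral:
      "\<lbrakk>tri D X Y U f a b; tri D Y Z W g c d; tri D X Z V (g \<cdot> f) p q\<rbrakk>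
        \<Longrightarrow> \<exists>u \<in> homset D U V. \<exists>v \<in> homset D V W.
              tri D U V W u v (shift_mor D a \<cdot> d) \<and>
              u \<cdot> a = p \<cdot> g \<and> q \<cdot> u = b \<and> v \<cdot> p = c \<and> d \<cdot> v = shift_mor D f \<cdot> q"

definition shift :: "('o, 'm, 'z) tricat_scheme \<Rightarrow> int \<Rightarrow> 'o \<Rightarrow> 'o" where
  "shift D n X =
     (if 0 \<le> n then (shift_obj D ^^ nat n) X
      else (inv_into (Obj D) (shift_obj D) ^^ nat (- n)) X)"


section \<open>Subcategories\<close>

text \<open>
  Full subcategories are given by their sets of objects. A full subcategory closed under
  isomorphisms is additive iff it contains the zero objects and is closed under direct sums.
\<close>

definition subcategory :: "('o, 'm, 'z) tricat_scheme \<Rightarrow> 'o set \<Rightarrow> bool" where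
  "subcategory D \<X> \<longleftrightarrow> \<X> \<subseteq> Obj D \<and>
     (\<forall>X Y. X \<in> \<X> \<and> isomorphic_objs D X Y \<longrightarrow> Y \<in> \<X>) \<and>
     (\<exists>Z \<in> \<X>. is_zero_obj D Z) \<and>
     (\<forall>X \<in> \<X>. \<forall>Y \<in> \<X>. \<forall>S. is_direct_sum D X Y S \<longrightarrow> S \<in> \<X>)"

definition shift_sub :: "('o, 'm, 'z) tricat_scheme \<Rightarrow> int \<Rightarrow> 'o set \<Rightarrow> 'o set" where
  "shift_sub D n \<X> = shift D n ` \<X>"

definition star :: "('o, 'm, 'z) tricat_scheme \<Rightarrow> 'o set \<Rightarrow> 'o set \<Rightarrow> 'o set" where
  "star D \<X> \<Y> = {Z \<in> Obj D. \<exists>X \<in> \<X>. \<exists>Y \<in> \<Y>. \<exists>f g h. tri D X Z Y f g h}"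

definition hom_vanish :: "('o, 'm, 'z) tricat_scheme \<Rightarrow> 'o set \<Rightarrow> 'o set \<Rightarrow> bool" where
  "hom_vanish D \<X> \<Y> \<longleftrightarrow> (\<forall>X \<in> \<X>. \<forall>Y \<in> \<Y>. homset D X Y = {zero_mor D X Y})"


section \<open>Bounded t-structures and extended hearts\<close>

text \<open>The pair \<open>t = (\<U>, \<V>)\<close> stands for \<open>(D\<^sup>\<le>\<^sup>0, D\<^sup>\<ge>\<^sup>0)\<close>.\<close>

definition bounded_t_structure ::
    "('o, 'm, 'z) tricat_scheme \<Rightarrow> 'o set \<times> 'o set \<Rightarrow> bool" where
  "bounded_t_structure D t \<longleftrightarrow> (case t of (\<U>, \<V>) \<Rightarrow>
     subcategory D \<U> \<and> subcategory D \<V> \<and>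
     shift_sub D 1 \<U> \<subseteq> \<U> \<and> shift_sub D (-1) \<V> \<subseteq> \<V> \<and>
     hom_vanish D \<U> (shift_sub D (-1) \<V>) \<and>
     Obj D = star D \<U> (shift_sub D (-1) \<V>) \<and>
     (\<forall>X \<in> Obj D. \<exists>n > 0. shift D n X \<in> \<U> \<and> shift D (- n) X \<in> \<V>))"

definition t_le :: "('o, 'm, 'z) tricat_scheme \<Rightarrow> 'o set \<times> 'o set \<Rightarrow> int \<Rightarrow> 'o set" where
  "t_le D t p = shift_sub D (- p) (fst t)"

definition t_ge :: "('o, 'm, 'z) tricat_scheme \<Rightarrow> 'o set \<times> 'o set \<Rightarrow> int \<Rightarrow> 'o set" where
  "t_ge D t p = shift_sub D (- p) (snd t)"

definition t_interval ::
    "('o, 'm, 'z) tricat_scheme \<Rightarrow> 'o set \<times> 'o set \<Rightarrow> int \<Rightarrow> int \<Rightarrow> 'o set" where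
  "t_interval D t p q = t_ge D t p \<inter> t_le D t q"

definition extended_heart ::
    "('o, 'm, 'z) tricat_scheme \<Rightarrow> 'o set \<times> 'o set \<Rightarrow> nat \<Rightarrow> 'o set" where
  "extended_heart D t m = t_interval D t (- (int m - 1)) 0"


section \<open>Torsion pairs\<close>

definition torsion_pair ::
    "('o, 'm, 'z) tricat_scheme \<Rightarrow> 'o set \<Rightarrow> 'o set \<Rightarrow> 'o set \<Rightarrow> bool" where
  "torsion_pair D \<E> \<T> \<F> \<longleftrightarrow>
     subcategory D \<T> \<and> \<T> \<subseteq> \<E> \<and> subcategory D \<F> \<and> \<F> \<subseteq> \<E> \<and>
     hom_vanish D \<T> \<F> \<and> \<E> = star D \<T> \<F>"

definition s_torsion_pair ::
    "('o, 'm, 'z) tricat_scheme \<Rightarrow> 'o set \<Rightarrow> 'o set \<Rightarrow> 'o set \<Rightarrow> bool" where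
  "s_torsion_pair D \<E> \<T> \<F> \<longleftrightarrow>
     torsion_pair D \<E> \<T> \<F> \<and> hom_vanish D \<T> (shift_sub D (-1) \<F>)"

definition torsion_t_structure ::
    "('o, 'm, 'z) tricat_scheme \<Rightarrow> 'o set \<times> 'o set \<Rightarrow> nat \<Rightarrow> 'o set \<Rightarrow> 'o set
      \<Rightarrow> 'o set \<times> 'o set" where
  "torsion_t_structure D t m \<T> \<F> =
     (star D (t_le D t (- int m)) \<T>, star D (shift_sub D 1 \<F>) (t_ge D t 0))"

end

theory Submission
  imports Defs
begin

text \<open>
  Write \<open>\<A> = D\<^sup>\<le>\<^sup>-\<^sup>m\<close> and \<open>\<B> = D\<^sup>\<ge>\<^sup>-\<^sup>m\<^sup>+\<^sup>1\<close>. Shifting the second component of the new t-structure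
  by \<open>m - 1\<close> turns \<open>\<F>[1] * D\<^sup>\<ge>\<^sup>0\<close> into \<open>\<F>[m] * \<B>\<close>, so the new extended heart is
  \<open>(\<F>[m] * \<B>) \<inter> (\<A> * \<T>)\<close>. As \<open>\<F>\<close> and \<open>\<T>\<close> lie in the old heart, \<open>\<F>[m] \<subseteq> \<A>\<close> and \<open>\<T> \<subseteq> \<B>\<close>. Hence an
  object \<open>Z\<close> of the new heart comes with two triangles, both of the form \<open>A \<rightarrow> Z \<rightarrow> B \<rightarrow> A[1]\<close>
  with \<open>A \<in> \<A>\<close> and \<open>B \<in> \<B>\<close>: in one of them \<open>A \<in> \<F>[m]\<close>, in the other \<open>B \<in> \<T>\<close>. Such a truncation
  triangle determines \<open>A\<close> up to isomorphism, because \<open>Hom(\<A>, \<B>) = 0\<close> and \<open>\<A>[1] \<subseteq> \<A>\<close>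
  (\<open>truncation_unique\<close>); so the second triangle has its left term in \<open>\<F>[m]\<close> as well, and the
  heart is \<open>\<F>[m] * \<T>\<close> (\<open>star_Int_star\<close>). The two vanishing conditions
  \<open>Hom(\<F>[m], \<T>) = 0\<close> and \<open>Hom(\<F>[m], \<T>[-1]) = Hom(\<F>[m+1], \<T>) = 0\<close> are instances
  of \<open>Hom(\<A>, \<B>) = 0\<close>.

  The identification of the new heart needs triangles and subcategories to be carried along the
  shift in both directions, which works because the shift is an automorphism (\<open>star_shift\<close>,
  \<open>subcategory_shift\<close>).
\<close>

section \<open>Subcategories\<close>

lemma subcategoryI:
  assumes "\<X> \<subseteq> Obj D" "\<exists>Z \<in> \<X>. is_zero_obj D Z"
    and "\<And>X Y. \<lbrakk>X \<in> \<X>; isomorphic_objs D X Y\<rbrakk> \<Longrightarrow> Y \<in> \<X>"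
    and "\<And>X Y S. \<lbrakk>X \<in> \<X>; Y \<in> \<X>; is_direct_sum D X Y S\<rbrakk> \<Longrightarrow> S \<in> \<X>"
  shows "subcategory D \<X>"
proof -
  have "\<forall>X Y. X \<in> \<X> \<and> isomorphic_objs D X Y \<longrightarrow> Y \<in> \<X>"
    by (intro allI impI) (elim conjE, rule assms(3))
  moreover have "\<forall>X \<in> \<X>. \<forall>Y \<in> \<X>. \<forall>S. is_direct_sum D X Y S \<longrightarrow> S \<in> \<X>"
    by (intro ballI allI impI) (rule assms(4))
  ultimately show ?thesis unfolding subcategory_def using assms(1,2) by (intro conjI)
qed

lemma subcategory_subset: "subcategory D \<X> \<Longrightarrow> \<X> \<subseteq> Obj D"
  unfolding subcategory_def by (elim conjE)

lemma subcategory_zero: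
  assumes "subcategory D \<X>"
  obtains Z where "Z \<in> \<X>" "is_zero_obj D Z"
  using assms unfolding subcategory_def by (elim conjE bexE)

lemma subcategory_isoD:
  assumes "subcategory D \<X>" "X \<in> \<X>" "isomorphic_objs D X Y"
  shows "Y \<in> \<X>"
proof -
  have "\<forall>X Y. X \<in> \<X> \<and> isomorphic_objs D X Y \<longrightarrow> Y \<in> \<X>"
    using assms(1) unfolding subcategory_def by (elim conjE)
  from mp[OF spec[OF spec[OF this]] conjI[OF assms(2,3)]] show ?thesis .
qed

lemma subcategory_sumD:
  assumes "subcategory D \<X>" "X \<in> \<X>" "Y \<in> \<X>" "is_direct_sum D X Y S"
  shows "S \<in> \<X>"
proof -
  have "\<forall>X \<in> \<X>. \<forall>Y \<in> \<X>. \<forall>S. is_direct_sum D X Y S \<longrightarrow> S \<in> \<X>"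
    using assms(1) unfolding subcategory_def by (elim conjE)
  from mp[OF spec[OF bspec[OF bspec[OF this assms(2)] assms(3)]] assms(4)] show ?thesis .
qed

lemma hom_vanish_mono: "\<lbrakk>hom_vanish D \<X> \<Y>; \<X>' \<subseteq> \<X>; \<Y>' \<subseteq> \<Y>\<rbrakk> \<Longrightarrow> hom_vanish D \<X>' \<Y>'"
  unfolding hom_vanish_def by blast

section \<open>Additivity of composition\<close>

context additive_category
begin

lemma zero_mor_closed:
  assumes "X \<in> Obj D" "Y \<in> Obj D"
  shows "zero_mor D X Y \<in> homset D X Y"
  using hom_comm_group[OF assms] by (simp add: comm_group_def group.is_monoid monoid.one_closed)

lemma neg_closed:
  assumes "X \<in> Obj D" "Y \<in> Obj D" "f \<in> homset D X Y"
  shows "inv\<^bsub>Hom D X Y\<^esub> f \<in> homset D X Y"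
  using hom_comm_group[OF assms(1,2)] assms(3) by (simp add: comm_group_def group.inv_closed)

lemma neg_neg:
  assumes "X \<in> Obj D" "Y \<in> Obj D" "f \<in> homset D X Y"
  shows "inv\<^bsub>Hom D X Y\<^esub> (inv\<^bsub>Hom D X Y\<^esub> f) = f"
  using hom_comm_group[OF assms(1,2)] assms(3) by (simp add: comm_group_def group.inv_inv)

lemma neg_zero:
  assumes "X \<in> Obj D" "Y \<in> Obj D"
  shows "inv\<^bsub>Hom D X Y\<^esub> (zero_mor D X Y) = zero_mor D X Y"
  using hom_comm_group[OF assms] by (simp add: comm_group_def group.is_monoid monoid.inv_one)

lemma group_hom_comp_left:
  assumes "X \<in> Obj D" "Y \<in> Obj D" "Z \<in> Obj D" "f \<in> homset D X Y"
  shows "group_hom (Hom D Y Z) (Hom D X Z) (\<lambda>g. g \<cdot> f)"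
  using hom_comm_group comp_additive_left[OF assms] assms
  by (simp add: group_hom_def group_hom_axioms_def comm_group_def)

lemma group_hom_comp_right:
  assumes "X \<in> Obj D" "Y \<in> Obj D" "Z \<in> Obj D" "g \<in> homset D Y Z"
  shows "group_hom (Hom D X Y) (Hom D X Z) (\<lambda>f. g \<cdot> f)"
  using hom_comm_group comp_additive_right[OF assms] assms
  by (simp add: group_hom_def group_hom_axioms_def comm_group_def)

lemma comp_zero_left:
  assumes "X \<in> Obj D" "Y \<in> Obj D" "Z \<in> Obj D" "f \<in> homset D X Y"
  shows "zero_mor D Y Z \<cdot> f = zero_mor D X Z"
  using group_hom.hom_one[OF group_hom_comp_left[OF assms]] .

lemma comp_zero_right:
  assumes "X \<in> Obj D" "Y \<in> Obj D" "Z \<in> Obj D" "g \<in> homset D Y Z"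
  shows "g \<cdot> zero_mor D X Y = zero_mor D X Z"
  using group_hom.hom_one[OF group_hom_comp_right[OF assms]] .

lemma comp_neg_left:
  assumes "X \<in> Obj D" "Y \<in> Obj D" "Z \<in> Obj D" "f \<in> homset D X Y" "g \<in> homset D Y Z"
  shows "inv\<^bsub>Hom D Y Z\<^esub> g \<cdot> f = inv\<^bsub>Hom D X Z\<^esub> (g \<cdot> f)"
  using group_hom.hom_inv[OF group_hom_comp_left[OF assms(1-4)] assms(5)] .

lemma comp_neg_right:
  assumes "X \<in> Obj D" "Y \<in> Obj D" "Z \<in> Obj D" "f \<in> homset D X Y" "g \<in> homset D Y Z"
  shows "g \<cdot> inv\<^bsub>Hom D X Y\<^esub> f = inv\<^bsub>Hom D X Z\<^esub> (g \<cdot> f)"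
  using group_hom.hom_inv[OF group_hom_comp_right[OF assms(1-3,5)] assms(4)] .

end

section \<open>The shift functor\<close>

context triangulated_category
begin

lemma shift_obj_closed: "X \<in> Obj D \<Longrightarrow> shift_obj D X \<in> Obj D"
  using shift_obj_bij by (auto simp: bij_betw_def)

lemma shift_obj_surj:
  assumes "Y \<in> Obj D"
  obtains X where "X \<in> Obj D" "Y = shift_obj D X"
  using shift_obj_bij assms by (auto simp: bij_betw_def)

lemma group_hom_shift_mor:
  assumes "X \<in> Obj D" "Y \<in> Obj D"
  shows "group_hom (Hom D X Y) (Hom D (shift_obj D X) (shift_obj D Y)) (shift_mor D)"
  using hom_comm_group shift_mor_iso[OF assms] assms shift_obj_closed
  by (simp add: group_hom_def group_hom_axioms_def comm_group_def iso_def)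

lemma shift_mor_closed:
  assumes "X \<in> Obj D" "Y \<in> Obj D" "f \<in> homset D X Y"
  shows "shift_mor D f \<in> homset D (shift_obj D X) (shift_obj D Y)"
  using group_hom.hom_closed[OF group_hom_shift_mor[OF assms(1,2)] assms(3)] .

lemma shift_mor_zero:
  assumes "X \<in> Obj D" "Y \<in> Obj D"
  shows "shift_mor D (zero_mor D X Y) = zero_mor D (shift_obj D X) (shift_obj D Y)"
  using group_hom.hom_one[OF group_hom_shift_mor[OF assms]] .

lemma shift_mor_add:
  assumes "X \<in> Obj D" "Y \<in> Obj D" "f \<in> homset D X Y" "g \<in> homset D X Y"
  shows "shift_mor D (f \<otimes>\<^bsub>Hom D X Y\<^esub> g) =
    shift_mor D f \<otimes>\<^bsub>Hom D (shift_obj D X) (shift_obj D Y)\<^esub> shift_mor D g"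
  using group_hom_shift_mor[OF assms(1,2)] assms(3,4)
  by (simp add: group_hom_def group_hom_axioms_def hom_mult)

lemma shift_mor_inj:
  assumes "X \<in> Obj D" "Y \<in> Obj D" "f \<in> homset D X Y" "g \<in> homset D X Y"
    and "shift_mor D f = shift_mor D g"
  shows "f = g"
  using shift_mor_iso[OF assms(1,2)] assms(3-5) by (auto simp: iso_def bij_betw_def inj_on_def)

lemma shift_mor_surj:
  assumes "X \<in> Obj D" "Y \<in> Obj D" "g \<in> homset D (shift_obj D X) (shift_obj D Y)"
  obtains f where "f \<in> homset D X Y" "g = shift_mor D f"
  using shift_mor_iso[OF assms(1,2)] assms(3) by (auto simp: iso_def bij_betw_def)

lemma homset_shift:
  assumes "X \<in> Obj D" "Y \<in> Obj D"
  shows "homset D (shift_obj D X) (shift_obj D Y) = shift_mor D ` homset D X Y"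
  using shift_mor_iso[OF assms] by (simp add: iso_def bij_betw_def)

lemma homset_shift_trivial_iff:
  assumes "X \<in> Obj D" "Y \<in> Obj D"
  shows "homset D (shift_obj D X) (shift_obj D Y) = {zero_mor D (shift_obj D X) (shift_obj D Y)}
    \<longleftrightarrow> homset D X Y = {zero_mor D X Y}"
proof
  assume "homset D X Y = {zero_mor D X Y}"
  then show "homset D (shift_obj D X) (shift_obj D Y)
      = {zero_mor D (shift_obj D X) (shift_obj D Y)}"
    using homset_shift[OF assms] shift_mor_zero[OF assms] by simp
next
  assume triv: "homset D (shift_obj D X) (shift_obj D Y)
      = {zero_mor D (shift_obj D X) (shift_obj D Y)}"
  have "f = zero_mor D X Y" if "f \<in> homset D X Y" for f
    using shift_mor_inj[OF assms that zero_mor_closed[OF assms]]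
      shift_mor_closed[OF assms that] triv shift_mor_zero[OF assms] by simp
  then show "homset D X Y = {zero_mor D X Y}"
    using zero_mor_closed[OF assms] by blast
qed

lemma is_zero_obj_shift:
  assumes "is_zero_obj D Z"
  shows "is_zero_obj D (shift_obj D Z)"
proof -
  have Z: "Z \<in> Obj D" using assms by (simp add: is_zero_obj_def)
  have "(\<exists>!f. f \<in> homset D (shift_obj D Z) Y) \<and> (\<exists>!f. f \<in> homset D Y (shift_obj D Z))"
    if Y: "Y \<in> Obj D" for Y
  proof -
    obtain X where X: "X \<in> Obj D" "Y = shift_obj D X" using shift_obj_surj[OF Y] .
    have "\<exists>!f. f \<in> homset D Z X" "\<exists>!f. f \<in> homset D X Z"
      using assms X(1) by (simp_all only: is_zero_obj_def)
    then obtain f g where "homset D Z X = {f}" "homset D X Z = {g}" by (elim ex1E) auto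
    then show ?thesis using X Z by (simp add: homset_shift)
  qed
  then show ?thesis using shift_obj_closed[OF Z] by (simp add: is_zero_obj_def)
qed

lemma isomorphic_objs_shiftD:
  assumes X: "X \<in> Obj D" and Y: "Y \<in> Obj D"
    and "isomorphic_objs D (shift_obj D X) (shift_obj D Y)"
  shows "isomorphic_objs D X Y"
proof -
  obtain f g where f: "f \<in> homset D (shift_obj D X) (shift_obj D Y)"
    and g: "g \<in> homset D (shift_obj D Y) (shift_obj D X)"
    and gf: "g \<cdot> f = ident D (shift_obj D X)" and fg: "f \<cdot> g = ident D (shift_obj D Y)"
    using assms(3) unfolding isomorphic_objs_def is_iso_def by blast
  obtain f' where f': "f' \<in> homset D X Y" "f = shift_mor D f'" using shift_mor_surj[OF X Y f] .
  obtain g' where g': "g' \<in> homset D Y X" "g = shift_mor D g'" using shift_mor_surj[OF Y X g] .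
  have "g' \<cdot> f' = ident D X"
    using shift_mor_inj[OF X X comp_closed[OF X Y X f'(1) g'(1)] ident_closed[OF X]]
      gf f' g' shift_comp[OF X Y X f'(1) g'(1)] shift_ident[OF X] by simp
  moreover have "f' \<cdot> g' = ident D Y"
    using shift_mor_inj[OF Y Y comp_closed[OF Y X Y g'(1) f'(1)] ident_closed[OF Y]]
      fg f' g' shift_comp[OF Y X Y g'(1) f'(1)] shift_ident[OF Y] by simp
  ultimately show ?thesis
    using X Y f'(1) g'(1) unfolding isomorphic_objs_def is_iso_def by blast
qed

lemma is_direct_sum_shiftD:
  assumes X: "X \<in> Obj D" and Y: "Y \<in> Obj D" and S: "S \<in> Obj D"
    and "is_direct_sum D (shift_obj D X) (shift_obj D Y) (shift_obj D S)"
  shows "is_direct_sum D X Y S"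
proof -
  obtain i j p q where i: "i \<in> homset D (shift_obj D X) (shift_obj D S)"
    and j: "j \<in> homset D (shift_obj D Y) (shift_obj D S)"
    and p: "p \<in> homset D (shift_obj D S) (shift_obj D X)"
    and q: "q \<in> homset D (shift_obj D S) (shift_obj D Y)"
    and eqs: "p \<cdot> i = ident D (shift_obj D X)" "q \<cdot> j = ident D (shift_obj D Y)"
      "p \<cdot> j = zero_mor D (shift_obj D Y) (shift_obj D X)"
      "q \<cdot> i = zero_mor D (shift_obj D X) (shift_obj D Y)"
      "(i \<cdot> p) \<otimes>\<^bsub>Hom D (shift_obj D S) (shift_obj D S)\<^esub> (j \<cdot> q) = ident D (shift_obj D S)"
    using assms(4) unfolding is_direct_sum_def by blast
  obtain i' where i': "i' \<in> homset D X S" "i = shift_mor D i'" using shift_mor_surj[OF X S i] .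
  obtain j' where j': "j' \<in> homset D Y S" "j = shift_mor D j'" using shift_mor_surj[OF Y S j] .
  obtain p' where p': "p' \<in> homset D S X" "p = shift_mor D p'" using shift_mor_surj[OF S X p] .
  obtain q' where q': "q' \<in> homset D S Y" "q = shift_mor D q'" using shift_mor_surj[OF S Y q] .
  have ip: "i' \<cdot> p' \<in> homset D S S" using comp_closed[OF S X S p'(1) i'(1)] .
  have jq: "j' \<cdot> q' \<in> homset D S S" using comp_closed[OF S Y S q'(1) j'(1)] .
  have sum: "(i' \<cdot> p') \<otimes>\<^bsub>Hom D S S\<^esub> (j' \<cdot> q') \<in> homset D S S"
    using hom_comm_group[OF S S] ip jq
    by (simp add: comm_group_def group.is_monoid monoid.m_closed)
  have "p' \<cdot> i' = ident D X"
    using shift_mor_inj[OF X X comp_closed[OF X S X i'(1) p'(1)] ident_closed[OF X]]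
      eqs(1) i' p' shift_comp[OF X S X i'(1) p'(1)] shift_ident[OF X] by simp
  moreover have "q' \<cdot> j' = ident D Y"
    using shift_mor_inj[OF Y Y comp_closed[OF Y S Y j'(1) q'(1)] ident_closed[OF Y]]
      eqs(2) j' q' shift_comp[OF Y S Y j'(1) q'(1)] shift_ident[OF Y] by simp
  moreover have "p' \<cdot> j' = zero_mor D Y X"
    using shift_mor_inj[OF Y X comp_closed[OF Y S X j'(1) p'(1)] zero_mor_closed[OF Y X]]
      eqs(3) j' p' shift_comp[OF Y S X j'(1) p'(1)] shift_mor_zero[OF Y X] by simp
  moreover have "q' \<cdot> i' = zero_mor D X Y"
    using shift_mor_inj[OF X Y comp_closed[OF X S Y i'(1) q'(1)] zero_mor_closed[OF X Y]]
      eqs(4) i' q' shift_comp[OF X S Y i'(1) q'(1)] shift_mor_zero[OF X Y] by simp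
  moreover have "(i' \<cdot> p') \<otimes>\<^bsub>Hom D S S\<^esub> (j' \<cdot> q') = ident D S"
    using shift_mor_inj[OF S S sum ident_closed[OF S]] eqs(5) i' j' p' q'
      shift_comp[OF S X S p'(1) i'(1)] shift_comp[OF S Y S q'(1) j'(1)]
      shift_mor_add[OF S S ip jq] shift_ident[OF S] by simp
  ultimately show ?thesis
    using X Y S i'(1) j'(1) p'(1) q'(1) unfolding is_direct_sum_def by blast
qed

lemma subcategory_shift:
  assumes "subcategory D \<X>"
  shows "subcategory D (shift_obj D ` \<X>)"
proof (rule subcategoryI)
  have sub: "\<X> \<subseteq> Obj D" using subcategory_subset[OF assms] .
  then show "shift_obj D ` \<X> \<subseteq> Obj D" using shift_obj_closed by blast
  obtain Z where "Z \<in> \<X>" "is_zero_obj D Z" using subcategory_zero[OF assms] .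
  then show "\<exists>Z \<in> shift_obj D ` \<X>. is_zero_obj D Z" using is_zero_obj_shift by auto
  show "Y \<in> shift_obj D ` \<X>"
    if X: "X \<in> shift_obj D ` \<X>" and iso: "isomorphic_objs D X Y" for X Y
  proof -
    obtain X' where X': "X' \<in> \<X>" "X = shift_obj D X'" using X by auto
    have "Y \<in> Obj D" using iso by (simp add: isomorphic_objs_def)
    then obtain Y' where Y': "Y' \<in> Obj D" "Y = shift_obj D Y'" by (rule shift_obj_surj)
    have "X' \<in> Obj D" using X'(1) sub by auto
    then have "isomorphic_objs D X' Y'"
      using Y'(1) iso unfolding X'(2) Y'(2) by (rule isomorphic_objs_shiftD)
    then have "Y' \<in> \<X>" by (rule subcategory_isoD[OF assms X'(1)])
    then show ?thesis using Y'(2) by simp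
  qed
  show "S \<in> shift_obj D ` \<X>"
    if X: "X \<in> shift_obj D ` \<X>" and Y: "Y \<in> shift_obj D ` \<X>"
      and sum: "is_direct_sum D X Y S" for X Y S
  proof -
    obtain X' where X': "X' \<in> \<X>" "X = shift_obj D X'" using X by auto
    obtain Y' where Y': "Y' \<in> \<X>" "Y = shift_obj D Y'" using Y by auto
    have "S \<in> Obj D" using sum by (simp add: is_direct_sum_def)
    then obtain S' where S': "S' \<in> Obj D" "S = shift_obj D S'" by (rule shift_obj_surj)
    have "X' \<in> Obj D" "Y' \<in> Obj D" using X'(1) Y'(1) sub by auto
    then have "is_direct_sum D X' Y' S'"
      using S'(1) sum unfolding X'(2) Y'(2) S'(2) by (rule is_direct_sum_shiftD)
    then have "S' \<in> \<X>" by (rule subcategory_sumD[OF assms X'(1) Y'(1)])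
    then show ?thesis using S'(2) by simp
  qed
qed

lemma hom_vanish_shift_iff:
  assumes "\<X> \<subseteq> Obj D" "\<Y> \<subseteq> Obj D"
  shows "hom_vanish D (shift_obj D ` \<X>) (shift_obj D ` \<Y>) \<longleftrightarrow> hom_vanish D \<X> \<Y>"
proof -
  have "homset D (shift_obj D X) (shift_obj D Y) = {zero_mor D (shift_obj D X) (shift_obj D Y)}
      \<longleftrightarrow> homset D X Y = {zero_mor D X Y}" if "X \<in> \<X>" "Y \<in> \<Y>" for X Y
    using that assms homset_shift_trivial_iff by blast
  then show ?thesis unfolding hom_vanish_def by simp
qed

section \<open>Triangles\<close>

text \<open>
  Three rotations turn a triangle into its shift, at the cost of a sign on each map; as rotation is
  reversible, so is this.
\<close>

lemma tri_shift_iff: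
  assumes X: "X \<in> Obj D" and Y: "Y \<in> Obj D" and Z: "Z \<in> Obj D"
    and f: "f \<in> homset D X Y" and g: "g \<in> homset D Y Z" and h: "h \<in> homset D Z (shift_obj D X)"
  shows "tri D X Y Z f g h \<longleftrightarrow>
    tri D (shift_obj D X) (shift_obj D Y) (shift_obj D Z)
      (inv\<^bsub>Hom D (shift_obj D X) (shift_obj D Y)\<^esub> (shift_mor D f))
      (inv\<^bsub>Hom D (shift_obj D Y) (shift_obj D Z)\<^esub> (shift_mor D g))
      (inv\<^bsub>Hom D (shift_obj D Z) (shift_obj D (shift_obj D X))\<^esub> (shift_mor D h))"
proof -
  note sX = shift_obj_closed[OF X] and sY = shift_obj_closed[OF Y]
    and sZ = shift_obj_closed[OF Z]
  note nf = neg_closed[OF sX sY shift_mor_closed[OF X Y f]]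
    and ng = neg_closed[OF sY sZ shift_mor_closed[OF Y Z g]]
  show ?thesis
    using tri_rotate[OF X Y Z f g h] tri_rotate[OF Y Z sX g h nf] tri_rotate[OF Z sX sY h nf ng]
    by simp
qed

text \<open>
  A triangle between shifted objects is itself a shifted triangle, because each of its maps is, up
  to sign, the shift of a map.
\<close>

lemma star_shift:
  assumes \<X>: "\<X> \<subseteq> Obj D" and \<Y>: "\<Y> \<subseteq> Obj D"
  shows "shift_obj D ` star D \<X> \<Y> = star D (shift_obj D ` \<X>) (shift_obj D ` \<Y>)"
proof
  show "shift_obj D ` star D \<X> \<Y> \<subseteq> star D (shift_obj D ` \<X>) (shift_obj D ` \<Y>)"
  proof
    fix W assume "W \<in> shift_obj D ` star D \<X> \<Y>"
    then obtain Z X Y f g h where W: "W = shift_obj D Z" and XY: "X \<in> \<X>" "Y \<in> \<Y>"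
      and t: "tri D X Z Y f g h"
      unfolding star_def by blast
    have "\<exists>f g h. tri D (shift_obj D X) W (shift_obj D Y) f g h"
      using tri_shift_iff[of X Z Y f g h] t tri_closed[OF t] W by blast
    moreover have "W \<in> Obj D" using tri_closed[OF t] shift_obj_closed W by blast
    ultimately show "W \<in> star D (shift_obj D ` \<X>) (shift_obj D ` \<Y>)"
      using XY unfolding star_def by blast
  qed
next
  have unshift: "\<exists>f' \<in> homset D A B. f = inv\<^bsub>Hom D (shift_obj D A) (shift_obj D B)\<^esub> (shift_mor D f')"
    if A: "A \<in> Obj D" and B: "B \<in> Obj D" and f: "f \<in> homset D (shift_obj D A) (shift_obj D B)"
    for A B f
  proof -
    note sA = shift_obj_closed[OF A] and sB = shift_obj_closed[OF B]
    obtain f' where f': "f' \<in> homset D A B"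
      "inv\<^bsub>Hom D (shift_obj D A) (shift_obj D B)\<^esub> f = shift_mor D f'"
      using shift_mor_surj[OF A B neg_closed[OF sA sB f]] .
    show ?thesis using f'(1) neg_neg[OF sA sB f] f'(2) by metis
  qed
  show "star D (shift_obj D ` \<X>) (shift_obj D ` \<Y>) \<subseteq> shift_obj D ` star D \<X> \<Y>"
  proof
    fix W assume "W \<in> star D (shift_obj D ` \<X>) (shift_obj D ` \<Y>)"
    then obtain X Y f g h where XY: "X \<in> \<X>" "Y \<in> \<Y>"
      and t: "tri D (shift_obj D X) W (shift_obj D Y) f g h"
      unfolding star_def by blast
    have X: "X \<in> Obj D" and Y: "Y \<in> Obj D" using XY \<X> \<Y> by auto
    obtain Z where Z: "Z \<in> Obj D" and W: "W = shift_obj D Z"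
      using shift_obj_surj tri_closed[OF t] by blast
    obtain f' where f': "f' \<in> homset D X Z"
      "f = inv\<^bsub>Hom D (shift_obj D X) (shift_obj D Z)\<^esub> (shift_mor D f')"
      using unshift[OF X Z] tri_closed[OF t] W by blast
    obtain g' where g': "g' \<in> homset D Z Y"
      "g = inv\<^bsub>Hom D (shift_obj D Z) (shift_obj D Y)\<^esub> (shift_mor D g')"
      using unshift[OF Z Y] tri_closed[OF t] W by blast
    obtain h' where h': "h' \<in> homset D Y (shift_obj D X)"
      "h = inv\<^bsub>Hom D (shift_obj D Y) (shift_obj D (shift_obj D X))\<^esub> (shift_mor D h')"
      using unshift[OF Y shift_obj_closed[OF X]] tri_closed[OF t] by blast
    have "tri D X Z Y f' g' h'"
      using tri_shift_iff[OF X Z Y f'(1) g'(1) h'(1)] t W f'(2) g'(2) h'(2) by simp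
    then show "W \<in> shift_obj D ` star D \<X> \<Y>" using XY Z W unfolding star_def by blast
  qed
qed

lemma subset_star_left:
  assumes "\<X> \<subseteq> Obj D" "Z \<in> \<Y>" "is_zero_obj D Z"
  shows "\<X> \<subseteq> star D \<X> \<Y>"
  using assms tri_ident unfolding star_def by blast

lemma subset_star_right:
  assumes "\<Y> \<subseteq> Obj D" "Z \<in> \<X>" "is_zero_obj D Z"
  shows "\<Y> \<subseteq> star D \<X> \<Y>"
proof
  fix Y assume Y\<Y>: "Y \<in> \<Y>"
  then have Y: "Y \<in> Obj D" using assms by blast
  have Z: "Z \<in> Obj D" using assms(3) by (simp add: is_zero_obj_def)
  note sZ = shift_obj_closed[OF Z] and sY = shift_obj_closed[OF Y]
  have "inv\<^bsub>Hom D (shift_obj D Z) (shift_obj D Y)\<^esub> (shift_mor D (zero_mor D Z Y))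
      = zero_mor D (shift_obj D Z) (shift_obj D Y)"
    using shift_mor_zero[OF Z Y] neg_zero[OF sZ sY] by simp
  \<comment> \<open>The triangle \<open>Z \<rightarrow> Y \<rightarrow> Y\<close> rotates to the identity triangle \<open>Y \<rightarrow> Y \<rightarrow> Z[1]\<close>.\<close>
  then have "tri D Z Y Y (zero_mor D Z Y) (ident D Y) (zero_mor D Y (shift_obj D Z))"
    using tri_rotate[OF Z Y Y zero_mor_closed[OF Z Y] ident_closed[OF Y] zero_mor_closed[OF Y sZ]]
      tri_ident[OF Y is_zero_obj_shift[OF assms(3)]] by simp
  then show "Y \<in> star D \<X> \<Y>" using Y Y\<Y> assms(2) unfolding star_def by blast
qed

lemma star_mono: "\<lbrakk>\<X> \<subseteq> \<X>'; \<Y> \<subseteq> \<Y>'\<rbrakk> \<Longrightarrow> star D \<X> \<Y> \<subseteq> star D \<X>' \<Y>'"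
  unfolding star_def by blast

text \<open>
  Exactness of \<open>Hom(W, -)\<close> at the middle term: the axiom TR3, applied to the rotations of
  \<open>W = W \<rightarrow> 0\<close> and of the given triangle, provides the shift of the factorisation.
\<close>

lemma tri_weak_kernel:
  assumes t: "tri D X Y Z f g h" and W: "W \<in> Obj D"
    and k: "k \<in> homset D W Y" and gk: "g \<cdot> k = zero_mor D W Z"
  obtains l where "l \<in> homset D W X" "f \<cdot> l = k"
proof -
  have X: "X \<in> Obj D" and Y: "Y \<in> Obj D" and Z: "Z \<in> Obj D"
    and f: "f \<in> homset D X Y" and g: "g \<in> homset D Y Z" and h: "h \<in> homset D Z (shift_obj D X)"
    using tri_closed[OF t] by auto
  obtain N where N0: "is_zero_obj D N" using zero_obj_exists by blast
  then have N: "N \<in> Obj D" by (simp add: is_zero_obj_def)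
  note sW = shift_obj_closed[OF W] and sX = shift_obj_closed[OF X] and sY = shift_obj_closed[OF Y]
  let ?id = "inv\<^bsub>Hom D (shift_obj D W) (shift_obj D W)\<^esub> (shift_mor D (ident D W))"
  let ?f = "inv\<^bsub>Hom D (shift_obj D X) (shift_obj D Y)\<^esub> (shift_mor D f)"
  have t1: "tri D W N (shift_obj D W) (zero_mor D W N) (zero_mor D N (shift_obj D W)) ?id"
    using tri_rotate[OF W W N ident_closed[OF W] zero_mor_closed[OF W N] zero_mor_closed[OF N sW]]
      tri_ident[OF W N0] by simp
  have t2: "tri D Y Z (shift_obj D X) g h ?f"
    using tri_rotate[OF X Y Z f g h] t by simp
  have "zero_mor D N Z \<cdot> zero_mor D W N = g \<cdot> k"
    using gk comp_zero_left[OF W N Z zero_mor_closed[OF W N]] by simp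
  then obtain w where w: "w \<in> homset D (shift_obj D W) (shift_obj D X)"
    and sq: "shift_mor D k \<cdot> ?id = ?f \<cdot> w"
    using tri_fill[OF t1 t2 k zero_mor_closed[OF N Z]] by blast
  obtain l where l: "l \<in> homset D W X" "w = shift_mor D l" using shift_mor_surj[OF W X w] .
  note sk = shift_mor_closed[OF W Y k] and sf = shift_mor_closed[OF X Y f]
    and sl = shift_mor_closed[OF W X l(1)]
  have fl: "f \<cdot> l \<in> homset D W Y" using comp_closed[OF W X Y l(1) f] .
  have "shift_mor D k \<cdot> ?id = inv\<^bsub>Hom D (shift_obj D W) (shift_obj D Y)\<^esub> (shift_mor D k)"
    using comp_neg_right[OF sW sW sY ident_closed[OF sW] sk] shift_ident[OF W]
      comp_ident_right[OF sW sY sk] by simp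
  moreover have "?f \<cdot> w = inv\<^bsub>Hom D (shift_obj D W) (shift_obj D Y)\<^esub> (shift_mor D (f \<cdot> l))"
    using comp_neg_left[OF sW sX sY sl sf] shift_comp[OF W X Y l(1) f] l(2) by simp
  ultimately have "shift_mor D (f \<cdot> l) = shift_mor D k"
    using sq neg_neg[OF sW sY sk] neg_neg[OF sW sY shift_mor_closed[OF W Y fl]] by metis
  then have "f \<cdot> l = k" using shift_mor_inj[OF W Y fl k] by simp
  with l(1) show thesis using that by blast
qed

text \<open>
  Exactness at the left term: the kernel of composition with \<open>f\<close> is covered by
  \<open>Hom(W, Z[-1]) = Hom(W[1], Z)\<close>.
\<close>

lemma tri_comp_zero_imp_zero:
  assumes t: "tri D X Y Z f g h" and W: "W \<in> Obj D"
    and van: "homset D (shift_obj D W) Z = {zero_mor D (shift_obj D W) Z}"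
    and k: "k \<in> homset D W X" and fk: "f \<cdot> k = zero_mor D W Y"
  shows "k = zero_mor D W X"
proof -
  have X: "X \<in> Obj D" and Y: "Y \<in> Obj D" and Z: "Z \<in> Obj D"
    and f: "f \<in> homset D X Y" and g: "g \<in> homset D Y Z" and h: "h \<in> homset D Z (shift_obj D X)"
    using tri_closed[OF t] by auto
  note sW = shift_obj_closed[OF W] and sX = shift_obj_closed[OF X] and sY = shift_obj_closed[OF Y]
  note sf = shift_mor_closed[OF X Y f] and sk = shift_mor_closed[OF W X k]
  let ?f = "inv\<^bsub>Hom D (shift_obj D X) (shift_obj D Y)\<^esub> (shift_mor D f)"
  let ?g = "inv\<^bsub>Hom D (shift_obj D Y) (shift_obj D Z)\<^esub> (shift_mor D g)"
  have t2: "tri D Z (shift_obj D X) (shift_obj D Y) h ?f ?g"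
    using tri_rotate[OF X Y Z f g h] tri_rotate[OF Y Z sX g h neg_closed[OF sX sY sf]] t by simp
  have "?f \<cdot> shift_mor D k = zero_mor D (shift_obj D W) (shift_obj D Y)"
    using comp_neg_left[OF sW sX sY sk sf] shift_comp[OF W X Y k f] fk shift_mor_zero[OF W Y]
      neg_zero[OF sW sY] by simp
  then obtain l where "l \<in> homset D (shift_obj D W) Z" "h \<cdot> l = shift_mor D k"
    using tri_weak_kernel[OF t2 sW sk] by blast
  then have "shift_mor D k = shift_mor D (zero_mor D W X)"
    using van comp_zero_right[OF sW Z sX h] shift_mor_zero[OF W X] by simp
  then show ?thesis using shift_mor_inj[OF W X k zero_mor_closed[OF W X]] by blast
qed

lemma tri_comp_inj:
  assumes t: "tri D X Y Z f g h" and W: "W \<in> Obj D"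
    and van: "homset D (shift_obj D W) Z = {zero_mor D (shift_obj D W) Z}"
    and k: "k \<in> homset D W X" and l: "l \<in> homset D W X" and eq: "f \<cdot> k = f \<cdot> l"
  shows "k = l"
proof -
  have X: "X \<in> Obj D" and Y: "Y \<in> Obj D" and f: "f \<in> homset D X Y"
    using tri_closed[OF t] by auto
  interpret group_hom "Hom D W X" "Hom D W Y" "\<lambda>k. f \<cdot> k"
    using group_hom_comp_right[OF W X Y f] .
  have d: "k \<otimes>\<^bsub>Hom D W X\<^esub> inv\<^bsub>Hom D W X\<^esub> l \<in> homset D W X" using k l by simp
  have "f \<cdot> (k \<otimes>\<^bsub>Hom D W X\<^esub> inv\<^bsub>Hom D W X\<^esub> l) = zero_mor D W Y" using k l eq by simp
  from tri_comp_zero_imp_zero[OF t W van d this] show ?thesis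
    using k l by (metis G.inv_closed G.inv_equality G.inv_inv)
qed

section \<open>Uniqueness of truncation\<close>

text \<open>
  Each of \<open>f\<close> and \<open>f'\<close> factors through the other because \<open>Hom(X, Y') = Hom(X', Y) = 0\<close>. The
  factorisations are mutually inverse because \<open>f\<close> and \<open>f'\<close> can be cancelled, and this is where
  the vanishing of maps out of \<open>X[1]\<close> and \<open>X'[1]\<close> enters.
\<close>

lemma truncation_unique:
  assumes van: "hom_vanish D \<A> \<B>" and \<A>: "shift_obj D ` \<A> \<subseteq> \<A>"
    and t: "tri D X Z Y f g h" "X \<in> \<A>" "Y \<in> \<B>"
    and t': "tri D X' Z Y' f' g' h'" "X' \<in> \<A>" "Y' \<in> \<B>"
  shows "isomorphic_objs D X X'"
proof -
  have X: "X \<in> Obj D" and Z: "Z \<in> Obj D" and Y: "Y \<in> Obj D"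
    and f: "f \<in> homset D X Z" and g: "g \<in> homset D Z Y"
    using tri_closed[OF t(1)] by auto
  have X': "X' \<in> Obj D" and Y': "Y' \<in> Obj D"
    and f': "f' \<in> homset D X' Z" and g': "g' \<in> homset D Z Y'"
    using tri_closed[OF t'(1)] by auto
  have v: "homset D A B = {zero_mor D A B}" if "A \<in> \<A>" "B \<in> \<B>" for A B
    using van that unfolding hom_vanish_def by blast
  have sX: "shift_obj D X \<in> \<A>" and sX': "shift_obj D X' \<in> \<A>" using \<A> t(2) t'(2) by auto
  have "g' \<cdot> f = zero_mor D X Y'"
    using v[OF t(2) t'(3)] comp_closed[OF X Z Y' f g'] by blast
  then obtain u where u: "u \<in> homset D X X'" "f' \<cdot> u = f"
    using tri_weak_kernel[OF t'(1) X f] by blast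
  have "g \<cdot> f' = zero_mor D X' Y"
    using v[OF t'(2) t(3)] comp_closed[OF X' Z Y f' g] by blast
  then obtain w where w: "w \<in> homset D X' X" "f \<cdot> w = f'"
    using tri_weak_kernel[OF t(1) X' f'] by blast
  have "f \<cdot> (w \<cdot> u) = f \<cdot> ident D X"
    using comp_assoc[OF X X' X Z u(1) w(1) f] w(2) u(2) comp_ident_right[OF X Z f] by simp
  then have wu: "w \<cdot> u = ident D X"
    using tri_comp_inj[OF t(1) X v[OF sX t(3)] comp_closed[OF X X' X u(1) w(1)] ident_closed[OF X]]
    by blast
  have "f' \<cdot> (u \<cdot> w) = f' \<cdot> ident D X'"
    using comp_assoc[OF X' X X' Z w(1) u(1) f'] w(2) u(2) comp_ident_right[OF X' Z f'] by simp
  then have "u \<cdot> w = ident D X'"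
    using tri_comp_inj[OF t'(1) X' v[OF sX' t'(3)] comp_closed[OF X' X X' w(1) u(1)]
        ident_closed[OF X']] by blast
  then show ?thesis
    using wu u(1) w(1) X X' unfolding isomorphic_objs_def is_iso_def by blast
qed

text \<open>
  The pair \<open>(\<A>, \<B>)\<close> plays the role of \<open>(D\<^sup>\<le>\<^sup>-\<^sup>m, D\<^sup>\<ge>\<^sup>-\<^sup>m\<^sup>+\<^sup>1)\<close>, and \<open>\<X>\<close>, \<open>\<Y>\<close> that of \<open>\<F>[m]\<close>, \<open>\<T>\<close>: an object
  whose truncation triangle can be chosen with left term in \<open>\<X>\<close>, and also with right term in \<open>\<Y>\<close>,
  has one triangle with both properties.
\<close>

lemma star_Int_star:
  assumes van: "hom_vanish D \<A> \<B>" and \<A>: "shift_obj D ` \<A> \<subseteq> \<A>"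
    and \<X>: "subcategory D \<X>" "\<X> \<subseteq> \<A>" and \<Y>: "\<Y> \<subseteq> \<B>"
  shows "star D \<X> \<B> \<inter> star D \<A> \<Y> = star D \<X> \<Y>"
proof
  show "star D \<X> \<Y> \<subseteq> star D \<X> \<B> \<inter> star D \<A> \<Y>"
    using star_mono \<X>(2) \<Y> by blast
  show "star D \<X> \<B> \<inter> star D \<A> \<Y> \<subseteq> star D \<X> \<Y>"
  proof
    fix Z assume Z: "Z \<in> star D \<X> \<B> \<inter> star D \<A> \<Y>"
    then obtain X B f g h where t: "tri D X Z B f g h" "X \<in> \<X>" "B \<in> \<B>"
      unfolding star_def by blast
    from Z obtain A Y f' g' h' where t': "tri D A Z Y f' g' h'" "A \<in> \<A>" "Y \<in> \<Y>"
      unfolding star_def by blast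
    have "isomorphic_objs D X A"
      using truncation_unique[OF van \<A> t(1) _ t(3) t'(1,2)] t(2) t'(3) \<X>(2) \<Y> by blast
    then have "A \<in> \<X>" by (rule subcategory_isoD[OF \<X>(1) t(2)])
    then show "Z \<in> star D \<X> \<Y>" using t' tri_closed[OF t'(1)] unfolding star_def by blast
  qed
qed

section \<open>Iterated shifts\<close>

lemma shift_sub_0: "shift_sub D 0 \<X> = \<X>"
  by (simp add: shift_sub_def shift_def)

lemma shift_sub_Suc: "shift_sub D (int (Suc n)) \<X> = shift_obj D ` shift_sub D (int n) \<X>"
proof -
  have "shift D (int (Suc n)) = (\<lambda>X. shift_obj D (shift D (int n) X))"
    by (rule ext) (simp only: shift_def of_nat_0_le_iff if_True nat_int funpow.simps comp_apply)
  then show ?thesis unfolding shift_sub_def by (simp only: image_image)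
qed

lemma shift_sub_1: "shift_sub D 1 \<X> = shift_obj D ` \<X>"
  using shift_sub_Suc[of 0] by (simp add: shift_sub_0)

lemma shift_sub_Suc': "shift_sub D (int (Suc n)) \<X> = shift_sub D (int n) (shift_obj D ` \<X>)"
  by (induction n) (simp_all only: shift_sub_Suc shift_sub_0 of_nat_0)

lemma shift_sub_neg1_closed:
  assumes "\<X> \<subseteq> Obj D"
  shows "shift_sub D (-1) \<X> \<subseteq> Obj D"
  using assms bij_betw_inv_into[OF shift_obj_bij]
  by (auto simp: shift_sub_def shift_def bij_betw_def)

lemma shift_shift_sub_neg1:
  assumes "\<X> \<subseteq> Obj D"
  shows "shift_obj D ` shift_sub D (-1) \<X> = \<X>"
proof -
  have "shift_obj D (shift D (-1) X) = X" if "X \<in> \<X>" for X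
    using that assms bij_betw_inv_into_right[OF shift_obj_bij] by (auto simp: shift_def)
  then show ?thesis by (simp add: shift_sub_def image_image)
qed

lemma shift_sub_closed:
  assumes "\<X> \<subseteq> Obj D"
  shows "shift_sub D (int n) \<X> \<subseteq> Obj D"
  using assms
  by (induction n) (auto simp only: shift_sub_0 shift_sub_Suc of_nat_0 intro: shift_obj_closed)

lemma shift_sub_mono: "\<X> \<subseteq> \<Y> \<Longrightarrow> shift_sub D n \<X> \<subseteq> shift_sub D n \<Y>"
  unfolding shift_sub_def by blast

lemma subcategory_shift_sub:
  assumes "subcategory D \<X>"
  shows "subcategory D (shift_sub D (int n) \<X>)"
  using assms by (induction n) (simp_all only: shift_sub_0 shift_sub_Suc of_nat_0 subcategory_shift)

lemma hom_vanish_shift_sub: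
  assumes "\<X> \<subseteq> Obj D" "\<Y> \<subseteq> Obj D" "hom_vanish D \<X> \<Y>"
  shows "hom_vanish D (shift_sub D (int n) \<X>) (shift_sub D (int n) \<Y>)"
  by (induction n)
    (simp_all only: assms shift_sub_0 shift_sub_Suc of_nat_0 hom_vanish_shift_iff shift_sub_closed)

lemma star_shift_sub:
  assumes "\<X> \<subseteq> Obj D" "\<Y> \<subseteq> Obj D"
  shows "shift_sub D (int n) (star D \<X> \<Y>)
    = star D (shift_sub D (int n) \<X>) (shift_sub D (int n) \<Y>)"
  by (induction n)
    (simp_all only: assms shift_sub_0 shift_sub_Suc of_nat_0 star_shift shift_sub_closed)

end

section \<open>The tilted torsion pair\<close>

theorem theorem0p1:
  fixes D :: "('o, 'm, 'z) tricat_scheme"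
    and t :: "'o set \<times> 'o set"
    and m :: nat
    and \<T> \<F> :: "'o set"
  assumes "m \<ge> 1"
    and "triangulated_category D"
    and "bounded_t_structure D t"
    and "s_torsion_pair D (extended_heart D t m) \<T> \<F>"
  shows "s_torsion_pair D (extended_heart D (torsion_t_structure D t m \<T> \<F>) m)
           (shift_sub D (int m) \<F>) \<T>"
proof -
  interpret triangulated_category D by fact
  obtain n where n: "m = Suc n" using assms(1) by (cases m) auto
  obtain \<U> \<V> where tUV: "t = (\<U>, \<V>)" by (cases t)
  have \<U>: "subcategory D \<U>" and \<V>: "subcategory D \<V>" and \<U>1: "shift_obj D ` \<U> \<subseteq> \<U>"
    and van: "hom_vanish D \<U> (shift_sub D (-1) \<V>)"
    using assms(3) by (auto simp: bounded_t_structure_def tUV shift_sub_1)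
  have \<U>obj: "\<U> \<subseteq> Obj D" and \<V>obj: "\<V> \<subseteq> Obj D" by (fact subcategory_subset[OF \<U>], fact subcategory_subset[OF \<V>])
  let ?A = "shift_sub D (int m) \<U>" and ?B = "shift_sub D (int n) \<V>"
    and ?Fm = "shift_sub D (int m) \<F>"
  have "extended_heart D t m = ?B \<inter> \<U>"
    by (simp add: extended_heart_def t_interval_def t_ge_def t_le_def tUV n shift_sub_0)
  then have \<T>: "subcategory D \<T>" "\<T> \<subseteq> ?B" and \<F>: "subcategory D \<F>" "\<F> \<subseteq> \<U>"
    using assms(4) by (auto simp: s_torsion_pair_def torsion_pair_def)
  have \<T>obj: "\<T> \<subseteq> Obj D" and \<F>obj: "\<F> \<subseteq> Obj D" by (fact subcategory_subset[OF \<T>(1)], fact subcategory_subset[OF \<F>(1)])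
  have Fm: "subcategory D ?Fm" "?Fm \<subseteq> ?A"
    using subcategory_shift_sub[OF \<F>(1)] shift_sub_mono[OF \<F>(2)] by auto
  have Fmobj: "?Fm \<subseteq> Obj D" using subcategory_subset[OF Fm(1)] .

  \<comment> \<open>The right-hand side is written as \<open>(D\<^sup>\<ge>\<^sup>0[-1])[m]\<close>, so that the orthogonality axiom applies.\<close>
  have "?B = shift_sub D (int m) (shift_sub D (-1) \<V>)"
    by (simp only: n shift_sub_Suc' shift_shift_sub_neg1[OF \<V>obj])
  then have AB: "hom_vanish D ?A ?B"
    using hom_vanish_shift_sub[OF \<U>obj shift_sub_neg1_closed[OF \<V>obj] van] by simp
  have A1: "shift_obj D ` ?A \<subseteq> ?A"
    using shift_sub_mono[OF \<U>1] by (metis shift_sub_Suc shift_sub_Suc')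

  have heart: "extended_heart D (torsion_t_structure D t m \<T> \<F>) m = star D ?Fm \<T>"
  proof -
    have "extended_heart D (torsion_t_structure D t m \<T> \<F>) m
        = shift_sub D (int n) (star D (shift_obj D ` \<F>) \<V>) \<inter> star D ?A \<T>"
      by (simp add: extended_heart_def t_interval_def t_ge_def t_le_def torsion_t_structure_def
          tUV n shift_sub_0 shift_sub_1 add.commute)
    also have "shift_sub D (int n) (star D (shift_obj D ` \<F>) \<V>) = star D ?Fm ?B"
      using star_shift_sub[of "shift_obj D ` \<F>" \<V> n] \<F>obj \<V>obj shift_obj_closed
      unfolding n shift_sub_Suc' by blast
    also have "star D ?Fm ?B \<inter> star D ?A \<T> = star D ?Fm \<T>"
      using star_Int_star[OF AB A1 Fm \<T>(2)] .
    finally show ?thesis .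
  qed

  have "?Fm \<subseteq> star D ?Fm \<T>"
    by (rule subcategory_zero[OF \<T>(1)]) (rule subset_star_left[OF Fmobj])
  moreover have "\<T> \<subseteq> star D ?Fm \<T>"
    by (rule subcategory_zero[OF Fm(1)]) (rule subset_star_right[OF \<T>obj])
  moreover have "hom_vanish D ?Fm \<T>"
    using hom_vanish_mono[OF AB Fm(2) \<T>(2)] .
  moreover have "hom_vanish D ?Fm (shift_sub D (-1) \<T>)"
  proof -
    \<comment> \<open>After one shift this becomes \<open>Hom(\<F>[m+1], \<T>) = 0\<close>, and \<open>\<F>[m+1]\<close> lies in \<open>D\<^sup>\<le>\<^sup>-\<^sup>m\<close>.\<close>
    have "shift_obj D ` ?Fm \<subseteq> ?A" using Fm(2) A1 by blast
    from hom_vanish_mono[OF AB this \<T>(2)]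
    show ?thesis
      using hom_vanish_shift_iff[OF Fmobj shift_sub_neg1_closed[OF \<T>obj]]
        shift_shift_sub_neg1[OF \<T>obj] by simp
  qed
  ultimately show ?thesis
    using heart Fm(1) \<T>(1) by (simp add: s_torsion_pair_def torsion_pair_def)
qed

end
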